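(* Let $N\ge 2$ and let $A_1,\ldots,A_N \in M_d(\mathbb{C})$. Put on each $\mathcal{W}_n^{(N)}$ the uniform probability measure, and let $\mathcal{W}^{(N)} = \prod_{n=1}^\infty \mathcal{W}_n^{(N)}$ with the product probability measure. Then for $\mathbf{w} = (w_1, w_2, \ldots) \in \mathcal{W}^{(N)}$, almost surely with respect to this product measure, $$F(w_n) \to e^{A_1 + \cdots + A_N}$$ in the matrix norm as $n \to \infty$.
   Context: $\mathcal{W}_n^{(N)}$ is the set of all words of length $Nn$ in $N$ formal (distinct) letters $A_1,\ldots,A_N$ containing exactly $n$ copies of each $A_j$, $1\le j\le N$. For $w\in\mathcal{W}_n^{(N)}$, $w[i]$ is the $i$-th letter of $w$ (interpreted as the corresponding matrix), and $F(w) = e^{w[1]/n}e^{w[2]/n}\cdots e^{w[Nn]/n} \in M_d(\mathbb{C})$, the product being taken in this order. $M_d(\mathbb{C})$ is the space of complex $d\times d$ matrices, equipped with a fixed sub-multiplicative norm. *)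

theory Defs
  imports "HOL-Probability.Probability"
begin

(* The library's exp, * and ^ act componentwise on the type complex^'d^'d, so the matrix
   exponential is defined here as a power series with respect to the matrix product **.
   The series is taken in the standard (Euclidean) topology of the space of matrices, which is
   the topology of every norm on it. *)
definition mexp :: "complex^'d^'d \<Rightarrow> complex^'d^'d" where
  "mexp A = (\<Sum>k. ((**) A ^^ k) (mat 1) /\<^sub>R fact k)"

definition submult_norm :: "(complex^'d^'d \<Rightarrow> real) \<Rightarrow> bool" where
  "submult_norm nrm \<longleftrightarrow>
     (\<forall>X. 0 \<le> nrm X) \<and>
     (\<forall>X. nrm X = 0 \<longleftrightarrow> X = 0) \<and>
     (\<forall>c X. nrm (map_matrix ((*) c) X) = cmod c * nrm X) \<and>
     (\<forall>X Y. nrm (X + Y) \<le> nrm X + nrm Y) \<and>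
     (\<forall>X Y. nrm (X ** Y) \<le> nrm X * nrm Y)"

(* The formal letters A_1, ..., A_N are represented by their indices 1, ..., N, so they are
   distinct even when some of the matrices coincide. *)
definition words :: "nat \<Rightarrow> nat \<Rightarrow> nat list set" where
  "words N n = {w. length w = N * n \<and> set w \<subseteq> {1..N} \<and> (\<forall>j\<in>{1..N}. count_list w j = n)}"

definition F :: "(nat \<Rightarrow> complex^'d^'d) \<Rightarrow> nat \<Rightarrow> nat list \<Rightarrow> complex^'d^'d" where
  "F A n w = foldr (\<lambda>j P. mexp (A j /\<^sub>R real n) ** P) w (mat 1)"

definition word_seq_measure :: "nat \<Rightarrow> (nat \<Rightarrow> nat list) measure" where
  "word_seq_measure N = (\<Pi>\<^sub>M n\<in>{1..}. uniform_count_measure (words N n))"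

end

theory Submission
  imports Defs "HOL-Combinatorics.Multiset_Permutations" "HOL-Real_Asymp.Real_Asymp"
begin

text \<open>
  Suppose that in every prefix of length \<open>k\<close> of a word, each letter occurs at most
  \<open>k / N + n powr (3/4)\<close> times. Then the partial sums \<open>T\<^sub>k\<close> of
  \<open>w[i] - (A\<^sub>1 + \<dots> + A\<^sub>N) / N\<close> are of order \<open>n powr (3/4)\<close>, and multiplying the \<open>k\<close>-th
  partial product of \<open>F(w)\<close> by \<open>1 - T\<^sub>k / n\<close> turns it into a sequence that follows the powers of
  \<open>exp ((A\<^sub>1 + \<dots> + A\<^sub>N) / (N n))\<close> up to an error of order \<open>n powr (-5/4)\<close> in each of the
  \<open>N n\<close> steps. Hence \<open>F(w)\<close> is within \<open>O(n powr (-1/4))\<close> of the limit.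

  The other words are rare. Among all sequences of \<open>N n\<close> letters they are controlled by the
  Chernoff bound, with a factor \<open>exp (- sqrt n / 4)\<close>, whereas the words with \<open>n\<close> copies of each
  letter make up at least a fraction \<open>1 / (e n)^N\<close> of all sequences. So their probabilities are
  summable in \<open>n\<close>, and the Borel--Cantelli lemma applies.
\<close>

section \<open>The Banach algebra of complex matrices\<close>

text \<open>A copy of the matrix space, so that \<open>*\<close>, \<open>^\<close> and
  \<open>exp\<close> of the type classes can mean the matrix operations; on
  \<open>complex^'d^'d\<close> itself they are componentwise. The norm chosen below is the operator
  norm, which satisfies \<open>norm 1 = 1\<close> as \<open>real_normed_algebra_1\<close> demands; a
  general submultiplicative norm may give the identity a larger value.\<close>

typedef 'd matalg = "UNIV :: (complex^'d^'d) set"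
  morphisms mat_of alg_of ..

setup_lifting type_definition_matalg

instantiation matalg :: (finite) real_normed_algebra_1
begin

lift_definition zero_matalg :: "'a matalg" is 0 .
lift_definition one_matalg :: "'a matalg" is "mat 1" .
lift_definition plus_matalg :: "'a matalg \<Rightarrow> 'a matalg \<Rightarrow> 'a matalg" is "(+)" .
lift_definition minus_matalg :: "'a matalg \<Rightarrow> 'a matalg \<Rightarrow> 'a matalg" is "(-)" .
lift_definition uminus_matalg :: "'a matalg \<Rightarrow> 'a matalg" is "uminus" .
lift_definition times_matalg :: "'a matalg \<Rightarrow> 'a matalg \<Rightarrow> 'a matalg" is "(**)" .
lift_definition scaleR_matalg :: "real \<Rightarrow> 'a matalg \<Rightarrow> 'a matalg" is "(*\<^sub>R)" .
lift_definition norm_matalg :: "'a matalg \<Rightarrow> real" is "\<lambda>X. onorm ((*v) X)" .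
definition sgn_matalg :: "'a matalg \<Rightarrow> 'a matalg" where "sgn_matalg X = scaleR (inverse (norm X)) X"
definition dist_matalg :: "'a matalg \<Rightarrow> 'a matalg \<Rightarrow> real" where "dist_matalg X Y = norm (X - Y)"
definition [code del]:
  "(uniformity :: ('a matalg \<times> 'a matalg) filter) = (INF e\<in>{0 <..}. principal {(x, y). dist x y < e})"
definition open_matalg :: "'a matalg set \<Rightarrow> bool"
  where [code del]: "open_matalg S = (\<forall>x\<in>S. \<forall>\<^sub>F (x', y) in uniformity. x' = x \<longrightarrow> y \<in> S)"

instance
proof
  have scaleR_mv: "(r *\<^sub>R X) *v v = r *\<^sub>R (X *v v)" for r and X :: "complex^'a^'a" and v
    by (simp add: vec_eq_iff matrix_vector_mult_def scaleR_right.sum)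
  show "\<And>x y z :: 'a matalg. x + y + z = x + (y + z)"
    by transfer simp
  show "\<And>x y :: 'a matalg. x + y = y + x"
    by transfer simp
  show "\<And>x :: 'a matalg. 0 + x = x"
    by transfer simp
  show "\<And>x :: 'a matalg. - x + x = 0"
    by transfer simp
  show "\<And>x y :: 'a matalg. x - y = x + - y"
    by transfer simp
  show "\<And>a (x :: 'a matalg) y. a *\<^sub>R (x + y) = a *\<^sub>R x + a *\<^sub>R y"
    by transfer (simp add: scaleR_add_right)
  show "\<And>a b (x :: 'a matalg). (a + b) *\<^sub>R x = a *\<^sub>R x + b *\<^sub>R x"
    by transfer (simp add: scaleR_add_left)
  show "\<And>a b (x :: 'a matalg). a *\<^sub>R b *\<^sub>R x = (a * b) *\<^sub>R x"
    by transfer simp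
  show "\<And>x :: 'a matalg. 1 *\<^sub>R x = x"
    by transfer simp
  show "\<And>x y z :: 'a matalg. x * y * z = x * (y * z)"
    by transfer (simp add: matrix_mul_assoc)
  show "\<And>x y z :: 'a matalg. (x + y) * z = x * z + y * z"
    by transfer (simp add: vec_eq_iff matrix_matrix_mult_def distrib_right sum.distrib)
  show "\<And>x y z :: 'a matalg. x * (y + z) = x * y + x * z"
    by transfer (simp add: vec_eq_iff matrix_matrix_mult_def distrib_left sum.distrib)
  show "\<And>a (x :: 'a matalg) y. a *\<^sub>R x * y = a *\<^sub>R (x * y)"
    by transfer (simp add: vec_eq_iff matrix_matrix_mult_def scaleR_right.sum)
  show "\<And>(x :: 'a matalg) a y. x * a *\<^sub>R y = a *\<^sub>R (x * y)"
    by transfer (simp add: vec_eq_iff matrix_matrix_mult_def scaleR_right.sum)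
  show "\<And>x :: 'a matalg. 1 * x = x"
    by transfer simp
  show "\<And>x :: 'a matalg. x * 1 = x"
    by transfer simp
  show "(0 :: 'a matalg) \<noteq> 1"
    by transfer (auto simp: vec_eq_iff mat_def)
  show "\<And>x y :: 'a matalg. dist x y = norm (x - y)"
    by (rule dist_matalg_def)
  show "\<And>x :: 'a matalg. sgn x = scaleR (inverse (norm x)) x"
    by (rule sgn_matalg_def)
  show "(uniformity :: ('a matalg \<times> 'a matalg) filter) = (INF e\<in>{0 <..}. principal {(x, y). dist x y < e})"
    by (rule uniformity_matalg_def)
  show "\<And>U :: 'a matalg set. open U = (\<forall>x\<in>U. \<forall>\<^sub>F (x', y) in uniformity. x' = x \<longrightarrow> y \<in> U)"
    by (rule open_matalg_def)
  show "norm x = 0 \<longleftrightarrow> x = 0" for x :: "'a matalg"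
    by transfer (simp add: onorm_eq_0 matrix_eq)
  show "norm (x + y) \<le> norm x + norm y" for x y :: "'a matalg"
  proof transfer
    fix x y :: "complex^'a^'a"
    show "onorm ((*v) (x + y)) \<le> onorm ((*v) x) + onorm ((*v) y)"
      using onorm_triangle[of "(*v) x" "(*v) y"]
      by (simp add: matrix_vector_mult_add_rdistrib[abs_def])
  qed
  show "norm (a *\<^sub>R x) = \<bar>a\<bar> * norm x" for a and x :: "'a matalg"
  proof transfer
    fix a and x :: "complex^'a^'a"
    show "onorm ((*v) (a *\<^sub>R x)) = \<bar>a\<bar> * onorm ((*v) x)"
      using onorm_scaleR[of "(*v) x" a] by (simp add: scaleR_mv[abs_def])
  qed
  show "norm (x * y) \<le> norm x * norm y" for x y :: "'a matalg"
  proof transfer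
    fix x y :: "complex^'a^'a"
    show "onorm ((*v) (x ** y)) \<le> onorm ((*v) x) * onorm ((*v) y)"
      using onorm_compose[of "(*v) x" "(*v) y"] by (simp add: o_def matrix_vector_mul_assoc)
  qed
  show "norm (1 :: 'a matalg) = 1"
    by transfer (simp add: matrix_vector_mul_lid[abs_def] onorm_id)
qed

end

lemma linear_alg_of: "linear alg_of"
  by (rule linearI; metis alg_of_inverse mat_of_inverse UNIV_I plus_matalg.rep_eq scaleR_matalg.rep_eq)

lemma bounded_linear_alg_of: "bounded_linear alg_of"
  using linear_alg_of linear_conv_bounded_linear by blast

text \<open>The entry is a coordinate of the image of the unit vector \<open>axis j 1\<close>. This
  is the link between the operator norm and entrywise estimates, both for the continuity of
  \<open>mat_of\<close> and for the comparison with an arbitrary norm.\<close>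

lemma norm_entry_le_matalg: "norm (mat_of X $ i $ j) \<le> norm X"
proof -
  have "norm (mat_of X $ i $ j) = norm ((mat_of X *v axis j 1) $ i)"
    by (simp add: matrix_vector_mult_def axis_def if_distrib cong: if_cong)
  also have "\<dots> \<le> norm (mat_of X *v axis j 1)"
    by (rule Finite_Cartesian_Product.norm_nth_le)
  also have "\<dots> \<le> onorm ((*v) (mat_of X)) * norm (axis j (1::complex))"
    by (rule onorm) simp
  also have "\<dots> = norm X"
    by (simp add: norm_matalg.rep_eq)
  finally show ?thesis .
qed

lemma bounded_linear_mat_of: "bounded_linear (mat_of :: 'd matalg \<Rightarrow> complex^'d^'d)"
proof (rule bounded_linear_intro)
  fix X :: "'d::finite matalg"
  have "norm (mat_of X) \<le> (\<Sum>i\<in>UNIV. norm (mat_of X $ i))"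
    by (simp add: norm_vec_def L2_set_le_sum)
  also have "\<dots> \<le> (\<Sum>i\<in>UNIV. \<Sum>j\<in>UNIV. norm (mat_of X $ i $ j))"
    by (intro sum_mono) (simp add: norm_vec_def L2_set_le_sum)
  also have "\<dots> \<le> (\<Sum>i\<in>(UNIV::'d set). \<Sum>j\<in>(UNIV::'d set). norm X)"
    by (intro sum_mono norm_entry_le_matalg)
  finally show "norm (mat_of X) \<le> norm X * (real CARD('d) * real CARD('d))"
    by (simp add: mult_ac)
qed (simp_all add: plus_matalg.rep_eq scaleR_matalg.rep_eq)

text \<open>Completeness is inherited from \<open>complex^'d^'d\<close>, since \<open>mat_of\<close>
  and \<open>alg_of\<close> are mutually inverse bounded linear maps.\<close>

instance matalg :: (finite) banach
proof
  fix X :: "nat \<Rightarrow> 'a matalg"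
  assume "Cauchy X"
  hence "Cauchy (\<lambda>n. mat_of (X n))"
    by (rule bounded_linear.Cauchy[OF bounded_linear_mat_of])
  then obtain L where "(\<lambda>n. mat_of (X n)) \<longlonglongrightarrow> L"
    using Cauchy_convergent convergent_def by blast
  hence "(\<lambda>n. alg_of (mat_of (X n))) \<longlonglongrightarrow> alg_of L"
    by (rule bounded_linear.tendsto[OF bounded_linear_alg_of])
  thus "convergent X"
    by (auto simp: mat_of_inverse convergent_def)
qed

text \<open>Iterated left multiplication by \<open>A\<close> gives the images under
  \<open>mat_of\<close> of the powers in the algebra, and the bounded linear map
  \<open>mat_of\<close> may be exchanged with the convergent series. From here on all estimates take
  place in the Banach algebra.\<close>

lemma mexp_eq_exp: "mexp A = mat_of (exp (alg_of A))"
proof -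
  have "((**) A ^^ k) (mat 1) = mat_of (alg_of A ^ k)" for k
    by (induction k) (simp_all add: one_matalg.rep_eq times_matalg.rep_eq alg_of_inverse)
  thus ?thesis
    using bounded_linear.suminf[OF bounded_linear_mat_of summable_exp_generic[of "alg_of A"]]
    by (simp add: mexp_def exp_def scaleR_matalg.rep_eq)
qed

lemma F_eq_prod_list:
  "F A n w = mat_of (prod_list (map (\<lambda>j. exp (alg_of (A j) /\<^sub>R real n)) w))"
  by (induction w)
     (simp_all add: F_def mexp_eq_exp one_matalg.rep_eq times_matalg.rep_eq linear_cmul[OF linear_alg_of])

text \<open>Carries convergence in the operator norm over to \<open>nrm\<close>. Expand
  \<open>X\<close> in the matrix units \<open>E i j\<close>, whose coefficients are bounded by the
  operator norm; \<open>C\<close> is the sum of the \<open>nrm (E i j)\<close>.\<close>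

lemma submult_norm_le:
  fixes nrm :: "complex^'d^'d \<Rightarrow> real"
  assumes "submult_norm nrm"
  obtains C where "\<And>X. nrm X \<le> C * norm (alg_of X)"
proof
  define E :: "'d \<Rightarrow> 'd \<Rightarrow> complex^'d^'d" where "E i j = (\<chi> a b. if a = i \<and> b = j then 1 else 0)" for i j
  have nonneg: "0 \<le> nrm X" and hom: "nrm (map_matrix ((*) c) X) = cmod c * nrm X"
    and tri: "nrm (X + Y) \<le> nrm X + nrm Y" and zero: "nrm 0 = 0" for c X Y
    using assms unfolding submult_norm_def by auto
  have sum_le: "nrm (sum f S) \<le> (\<Sum>x\<in>S. nrm (f x))" if "finite S" for f :: "'d \<Rightarrow> complex^'d^'d" and S
    using that by (induction S rule: finite_induct) (auto simp: zero intro: order_trans[OF tri])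
  fix X :: "complex^'d^'d"
  have "X = (\<Sum>i\<in>UNIV. \<Sum>j\<in>UNIV. map_matrix ((*) (X $ i $ j)) (E i j))"
  proof -
    have "(\<Sum>i\<in>UNIV. \<Sum>j\<in>UNIV. X $ i $ j * (if a = i \<and> b = j then 1 else 0)) =
        (\<Sum>i\<in>UNIV. if a = i then \<Sum>j\<in>UNIV. if b = j then X $ i $ j else 0 else 0)" for a b
      by (intro sum.cong) (auto intro!: sum.cong simp del: sum.delta sum.delta')
    thus ?thesis
      by (simp add: vec_eq_iff E_def map_matrix_def)
  qed
  also have "nrm \<dots> \<le> (\<Sum>i\<in>UNIV. \<Sum>j\<in>UNIV. nrm (map_matrix ((*) (X $ i $ j)) (E i j)))"
    by (intro order_trans[OF sum_le] sum_mono) auto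
  also have "\<dots> \<le> (\<Sum>i\<in>UNIV. \<Sum>j\<in>UNIV. norm (alg_of X) * nrm (E i j))"
    using norm_entry_le_matalg[of "alg_of X"]
    by (intro sum_mono) (auto simp: hom alg_of_inverse intro!: mult_right_mono nonneg)
  finally show "nrm X \<le> (\<Sum>i\<in>UNIV. \<Sum>j\<in>UNIV. nrm (E i j)) * norm (alg_of X)"
    by (simp add: sum_distrib_left sum_distrib_right mult_ac)
qed

section \<open>Products of exponentials with small discrepancy\<close>

text \<open>Since \<open>fact (n + k)\<close> is at least \<open>fact n\<close>, the factor
  \<open>norm x ^ k\<close> can be taken out of the tail, and the exponential series of
  \<open>norm x\<close> remains as a majorant.\<close>

lemma norm_exp_tail_le:
  fixes x :: "'a::{real_normed_algebra_1, banach}"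
  shows "norm (\<Sum>n. inverse (fact (n + k)) *\<^sub>R x ^ (n + k)) \<le> norm x ^ k * exp (norm x)"
proof -
  have "norm (inverse (fact (n + k)) *\<^sub>R x ^ (n + k)) \<le> norm x ^ k * (norm x ^ n /\<^sub>R fact n)" for n
  proof -
    have "norm (inverse (fact (n + k)) *\<^sub>R x ^ (n + k)) \<le> inverse (fact (n + k)) * norm x ^ (n + k)"
      by (simp add: norm_power_ineq mult_left_mono)
    also have "\<dots> \<le> inverse (fact n) * norm x ^ (n + k)"
      by (intro mult_right_mono le_imp_inverse_le fact_mono) auto
    finally show ?thesis
      by (simp add: power_add field_simps)
  qed
  moreover have "(\<lambda>n. norm x ^ k * (norm x ^ n /\<^sub>R fact n)) sums (norm x ^ k * exp (norm x))"
    by (intro sums_mult exp_converges)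
  ultimately show ?thesis
    using norm_suminf_le[OF _ sums_summable, of _ "\<lambda>n. norm x ^ k * (norm x ^ n /\<^sub>R fact n)"]
    by (metis (no_types, lifting) sums_unique)
qed

lemma norm_exp_minus_1_le:
  fixes x :: "'a::{real_normed_algebra_1, banach}"
  shows "norm (exp x - 1) \<le> norm x * exp (norm x)"
  using norm_exp_tail_le[of 1 x] exp_first_term[of x] by simp

lemma norm_exp_minus_1_minus_le:
  fixes x :: "'a::{real_normed_algebra_1, banach}"
  shows "norm (exp x - 1 - x) \<le> norm x ^ 2 * exp (norm x)"
  using norm_exp_tail_le[of 2 x] exp_first_two_terms[of x] by (simp add: algebra_simps)

lemma exp_of_nat_scaleR:
  fixes x :: "'a::{real_normed_algebra_1, banach}"
  shows "exp (real n *\<^sub>R x) = exp x ^ n"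
proof (induction n)
  case (Suc n)
  have "exp (real (Suc n) *\<^sub>R x) = exp (x + real n *\<^sub>R x)"
    by (simp add: scaleR_left_distrib)
  also have "\<dots> = exp x * exp (real n *\<^sub>R x)"
    by (rule exp_add_commuting) simp
  finally show ?case using Suc by simp
qed simp

text \<open>The summand \<open>h * D\<close> is the cost of removing the correction factor after the
  last step; the other summand collects \<open>M\<close> one-step errors of second order in
  \<open>h\<close>. The factor \<open>exp (h * K) ^ M\<close> accounts for the growth of the
  products. For \<open>h = 1 / n\<close> and \<open>M\<close> of order \<open>n\<close> the bound is
  of order \<open>(1 + D) / n\<close>.\<close>

lemma norm_prod_list_exp_diff_le:
  fixes x :: "nat \<Rightarrow> 'a::{real_normed_algebra_1, banach}" and y :: 'a and h K D :: real
  assumes h: "0 \<le> h" "h \<le> 1"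
    and x: "\<And>i. norm (x i) \<le> K" and y: "norm y \<le> K"
    and D: "\<And>k. k \<le> M \<Longrightarrow> norm (\<Sum>i<k. x i - y) \<le> D"
  shows "norm (prod_list (map (\<lambda>i. exp (h *\<^sub>R x i)) [0..<M]) - exp (h *\<^sub>R y) ^ M)
    \<le> (h * D + real M * (2 * h\<^sup>2 * K * exp K * (2 * K + D))) * exp (h * K) ^ M"
proof -
  define T where "T k = (\<Sum>i<k. x i - y)" for k
  define u where "u i = exp (h *\<^sub>R x i)" for i
  define E where "E = exp (h *\<^sub>R y)"
  define G where "G = exp (h * K)"
  define P where "P k = prod_list (map u [0..<k])" for k
  \<comment> \<open>The correction factor cancels the first-order part of \<open>u k - E\<close>, so that the corrected
    products follow the powers of \<open>E\<close> with errors of second order in \<open>h\<close>.\<close>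
  define Z where "Z k = P k * (1 - h *\<^sub>R T k)" for k
  define \<epsilon> where "\<epsilon> = 2 * h\<^sup>2 * K * exp K * (2 * K + D)"
  have K0: "0 \<le> K" using norm_ge_zero y order_trans by blast
  have D0: "0 \<le> D" using D[of 0] by simp
  have "\<epsilon> \<ge> 0" using K0 D0 by (simp add: \<epsilon>_def)
  have "G \<ge> 1" using h K0 by (simp add: G_def)
  have exp_bounds: "norm (exp (h *\<^sub>R z)) \<le> G" "norm (exp (h *\<^sub>R z) - 1) \<le> h * K * exp K"
    "norm (exp (h *\<^sub>R z) - 1 - h *\<^sub>R z) \<le> (h * K)\<^sup>2 * exp K" if z: "norm z \<le> K" for z :: 'a
  proof -
    have n: "norm (h *\<^sub>R z) \<le> h * K" using z h by (simp add: mult_left_mono)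
    \<comment> \<open>Here \<open>h \<le> 1\<close> enters: the remainder factors
      \<open>exp (h * K)\<close> are replaced by \<open>exp K\<close>, which is free of
      \<open>h\<close>.\<close>
    have hK: "h * K \<le> K" using h K0 by (simp add: mult_left_le_one_le)
    show "norm (exp (h *\<^sub>R z)) \<le> G"
      using norm_exp[of "h *\<^sub>R z"] n unfolding G_def by (meson exp_le_cancel_iff order_trans)
    have "norm (exp (h *\<^sub>R z) - 1) \<le> norm (h *\<^sub>R z) * exp (norm (h *\<^sub>R z))"
      by (rule norm_exp_minus_1_le)
    also have "\<dots> \<le> h * K * exp K"
      using n hK h K0 by (intro mult_mono) auto
    finally show "norm (exp (h *\<^sub>R z) - 1) \<le> h * K * exp K" .
    have "norm (exp (h *\<^sub>R z) - 1 - h *\<^sub>R z) \<le> norm (h *\<^sub>R z) ^ 2 * exp (norm (h *\<^sub>R z))"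
      by (rule norm_exp_minus_1_minus_le)
    also have "\<dots> \<le> (h * K)\<^sup>2 * exp K"
      using n hK h K0 by (intro mult_mono power_mono) auto
    finally show "norm (exp (h *\<^sub>R z) - 1 - h *\<^sub>R z) \<le> (h * K)\<^sup>2 * exp K" .
  qed
  have P_Suc: "P (Suc k) = P k * u k" for k by (simp add: P_def)
  have normP: "norm (P k) \<le> G ^ k" for k
  proof (induction k)
    case (Suc k)
    have "norm (P (Suc k)) \<le> norm (P k) * norm (u k)"
      by (simp add: P_Suc norm_mult_ineq)
    also have "\<dots> \<le> G ^ k * G"
      using Suc exp_bounds(1)[OF x] \<open>G \<ge> 1\<close> by (intro mult_mono) (auto simp: u_def)
    finally show ?case by (simp add: mult_ac)
  qed (simp add: P_def)
  have step: "norm (Z (Suc k) - Z k * E) \<le> G ^ k * \<epsilon>" if "k \<le> M" for k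
  proof -
    \<comment> \<open>This is \<open>u k * (1 - h *\<^sub>R T (Suc k)) - (1 - h *\<^sub>R T k) *
      E\<close> regrouped. The two terms \<open>h *\<^sub>R T k\<close> cancel, and the increment
      \<open>x k - y\<close> of \<open>T\<close> cancels the first-order part of
      \<open>u k - E\<close>. What remains is a second-order remainder of \<open>exp\<close>, or
      \<open>h\<close> times a product containing \<open>u k - 1\<close> or
      \<open>E - 1\<close>.\<close>
    let ?R = "(u k - 1 - h *\<^sub>R x k) - (E - 1 - h *\<^sub>R y) - h *\<^sub>R ((u k - 1) * T k)
      - h *\<^sub>R ((u k - 1) * (x k - y)) + h *\<^sub>R (T k * (E - 1))"
    have "Z (Suc k) - Z k * E = P k * ?R"
      by (simp add: Z_def P_Suc T_def algebra_simps)
    moreover have "norm ?R \<le> \<epsilon>"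
    proof -
      let ?\<sigma> = "h * K * exp K"
      have "?\<sigma> \<ge> 0" using h K0 by simp
      have tri: "norm (p - q - r - s + t) \<le> norm p + norm q + norm r + norm s + norm t" for p q r s t :: 'a
        using norm_triangle_ineq[of "p - q - r - s" t] norm_triangle_ineq4[of "p - q - r" s]
          norm_triangle_ineq4[of "p - q" r] norm_triangle_ineq4[of p q] by linarith
      have b1: "norm (u k - 1 - h *\<^sub>R x k) \<le> (h * K)\<^sup>2 * exp K" "norm (E - 1 - h *\<^sub>R y) \<le> (h * K)\<^sup>2 * exp K"
        using exp_bounds(3) x y by (auto simp: u_def E_def)
      have Tk: "norm (T k) \<le> D" using D that by (simp add: T_def)
      have us: "norm (u k - 1) \<le> ?\<sigma>" "norm (E - 1) \<le> ?\<sigma>"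
        using exp_bounds(2) x y by (auto simp: u_def E_def)
      have xy: "norm (x k - y) \<le> 2 * K" using norm_triangle_ineq4[of "x k" y] x[of k] y by linarith
      have "norm ((u k - 1) * T k) \<le> ?\<sigma> * D"
        by (rule order_trans[OF norm_mult_ineq]) (intro mult_mono us Tk \<open>?\<sigma> \<ge> 0\<close> norm_ge_zero)
      hence b2: "norm (h *\<^sub>R ((u k - 1) * T k)) \<le> h * (?\<sigma> * D)"
        using h by (simp add: mult_left_mono)
      have "norm ((u k - 1) * (x k - y)) \<le> ?\<sigma> * (2 * K)"
        by (rule order_trans[OF norm_mult_ineq]) (intro mult_mono us xy \<open>?\<sigma> \<ge> 0\<close> norm_ge_zero)
      hence b3: "norm (h *\<^sub>R ((u k - 1) * (x k - y))) \<le> h * (?\<sigma> * (2 * K))"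
        using h by (simp add: mult_left_mono)
      have "norm (T k * (E - 1)) \<le> D * ?\<sigma>"
        by (rule order_trans[OF norm_mult_ineq]) (intro mult_mono us Tk D0 norm_ge_zero)
      hence b4: "norm (h *\<^sub>R (T k * (E - 1))) \<le> h * (D * ?\<sigma>)"
        using h by (simp add: mult_left_mono)
      have "norm ?R \<le> (h * K)\<^sup>2 * exp K + (h * K)\<^sup>2 * exp K + h * (?\<sigma> * D) + h * (?\<sigma> * (2 * K))
          + h * (D * ?\<sigma>)"
        using b1 b2 b3 b4 tri[of "u k - 1 - h *\<^sub>R x k" "E - 1 - h *\<^sub>R y" "h *\<^sub>R ((u k - 1) * T k)"
            "h *\<^sub>R ((u k - 1) * (x k - y))" "h *\<^sub>R (T k * (E - 1))"]
        by linarith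
      also have "\<dots> = \<epsilon>" by (simp add: \<epsilon>_def power2_eq_square algebra_simps)
      finally show ?thesis .
    qed
    ultimately have "norm (Z (Suc k) - Z k * E) \<le> norm (P k) * norm ?R"
      by (metis norm_mult_ineq)
    also have "\<dots> \<le> G ^ k * \<epsilon>"
      using normP[of k] \<open>norm ?R \<le> \<epsilon>\<close> \<open>G \<ge> 1\<close> by (intro mult_mono) auto
    finally show ?thesis .
  qed
  have Z: "norm (Z k - E ^ k) \<le> real k * \<epsilon> * G ^ k" if "k \<le> M" for k
    using that
  proof (induction k)
    case (Suc k)
    \<comment> \<open>The accumulated error is multiplied by \<open>E\<close>, whose norm is at most
      \<open>G\<close>, and the new one-step error is added.\<close>
    have eq: "Z (Suc k) - E ^ Suc k = (Z (Suc k) - Z k * E) + (Z k - E ^ k) * E"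
      by (simp add: algebra_simps power_commutes)
    have "norm (Z (Suc k) - E ^ Suc k) \<le> norm (Z (Suc k) - Z k * E) + norm (Z k - E ^ k) * norm E"
      using norm_triangle_ineq[of "Z (Suc k) - Z k * E" "(Z k - E ^ k) * E"]
        norm_mult_ineq[of "Z k - E ^ k" E] unfolding eq by linarith
    also have "\<dots> \<le> G ^ k * \<epsilon> + real k * \<epsilon> * G ^ k * G"
      using Suc step[of k] exp_bounds(1)[OF y] \<open>G \<ge> 1\<close> \<open>\<epsilon> \<ge> 0\<close>
      by (intro add_mono mult_mono) (auto simp: E_def)
    also have "\<dots> \<le> G ^ Suc k * \<epsilon> + real k * \<epsilon> * G ^ Suc k"
      using \<open>G \<ge> 1\<close> \<open>\<epsilon> \<ge> 0\<close> by (intro add_mono mult_right_mono power_increasing) (auto simp: mult_ac)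
    finally show ?case by (simp add: algebra_simps)
  qed (simp add: Z_def P_def T_def)
  have "norm (P M * (h *\<^sub>R T M)) \<le> G ^ M * (h * D)"
    using normP[of M] D[of M] h \<open>G \<ge> 1\<close>
    by (intro order_trans[OF norm_mult_ineq] mult_mono) (auto simp: T_def mult_left_mono)
  moreover have eq: "P M - E ^ M = P M * (h *\<^sub>R T M) + (Z M - E ^ M)"
    by (simp add: Z_def algebra_simps)
  ultimately have "norm (P M - E ^ M) \<le> G ^ M * (h * D) + real M * \<epsilon> * G ^ M"
    using Z[of M] norm_triangle_ineq[of "P M * (h *\<^sub>R T M)" "Z M - E ^ M"] unfolding eq by linarith
  thus ?thesis
    by (simp add: P_def u_def[abs_def] E_def G_def \<epsilon>_def algebra_simps)
qed

section \<open>Letter counts in prefixes and the estimate for a single word\<close>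

lemma sum_list_map_eq_sum_count_scaleR:
  fixes a :: "'b \<Rightarrow> 'a::real_vector"
  assumes "finite S" "set xs \<subseteq> S"
  shows "sum_list (map a xs) = (\<Sum>j\<in>S. real (count_list xs j) *\<^sub>R a j)"
  using assms(2)
proof (induction xs)
  case (Cons x xs)
  have "(\<Sum>j\<in>S. real (count_list (x # xs) j) *\<^sub>R a j) =
      (\<Sum>j\<in>S. (if x = j then a j else 0) + real (count_list xs j) *\<^sub>R a j)"
    by (intro sum.cong) (auto simp: algebra_simps)
  thus ?case
    using Cons assms(1) by (simp add: sum.distrib)
qed simp

text \<open>Upper bounds on the counts imply lower ones: the counts add up to the length, so if no
  letter exceeds its share by more than \<open>\<delta>\<close>, none falls short by more than
  \<open>(N - 1) * \<delta>\<close>. Each of the \<open>N\<close> letters thus contributes at most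
  \<open>N * \<delta> * K\<close>. Hence only upper tails have to be controlled later.\<close>

lemma norm_prefix_discrepancy_le:
  fixes a :: "nat \<Rightarrow> 'a::real_normed_vector"
  assumes w: "set w \<subseteq> {1..N}" and a: "\<And>j. j \<in> {1..N} \<Longrightarrow> norm (a j) \<le> K"
    and count: "\<And>j. j \<in> {1..N} \<Longrightarrow> real (count_list w j) \<le> real (length w) / real N + \<delta>"
    and "0 \<le> \<delta>" "0 < N"
  shows "norm (sum_list (map a w) - (real (length w) / real N) *\<^sub>R (\<Sum>j=1..N. a j)) \<le> real N ^ 2 * \<delta> * K"
proof -
  let ?k = "real (length w)"
  have dev: "\<bar>real (count_list w j) - ?k / N\<bar> \<le> real N * \<delta>" if j: "j \<in> {1..N}" for j
  proof -
    have "?k = real (\<Sum>i\<in>{1..N}. count_list w i)"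
      using w by (simp add: sum_count_set)
    also have "\<dots> = real (count_list w j) + (\<Sum>i\<in>{1..N} - {j}. real (count_list w i))"
      using j by (simp add: sum.remove)
    also have "(\<Sum>i\<in>{1..N} - {j}. real (count_list w i)) \<le> (\<Sum>i\<in>{1..N} - {j}. ?k / N + \<delta>)"
      by (intro sum_mono count) auto
    also have "\<dots> = (real N - 1) * (?k / N + \<delta>)"
      using j \<open>0 < N\<close> by (simp add: of_nat_diff)
    also have "\<dots> = ?k - ?k / N + (real N * \<delta> - \<delta>)"
      using \<open>0 < N\<close> by (simp add: field_simps)
    finally have "?k / N - real (count_list w j) \<le> real N * \<delta>"
      using \<open>0 \<le> \<delta>\<close> by simp
    moreover have "\<delta> \<le> real N * \<delta>"
      using \<open>0 \<le> \<delta>\<close> \<open>0 < N\<close> by (simp add: mult_le_cancel_right1)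
    ultimately show ?thesis
      using count[OF j] by simp
  qed
  have "sum_list (map a w) - (?k / N) *\<^sub>R (\<Sum>j=1..N. a j) =
      (\<Sum>j=1..N. (real (count_list w j) - ?k / N) *\<^sub>R a j)"
    using w by (simp add: sum_list_map_eq_sum_count_scaleR[of "{1..N}"] scaleR_sum_right
        sum_subtractf scaleR_left_diff_distrib)
  also have "norm \<dots> \<le> (\<Sum>j=1..N. real N * \<delta> * K)"
    using dev a \<open>0 \<le> \<delta>\<close> by (intro sum_norm_le) (auto intro!: mult_mono)
  finally show ?thesis
    by (simp add: power2_eq_square mult_ac)
qed

text \<open>The general product estimate with \<open>h = 1 / n\<close>, \<open>M = N * n\<close> and
  \<open>y\<close> the average of the letters, for which \<open>exp (h *\<^sub>R y) ^ M\<close> is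
  exactly the exponential of the sum.\<close>

lemma norm_word_product_diff_le:
  fixes a :: "nat \<Rightarrow> 'a::{real_normed_algebra_1, banach}"
  assumes w: "w \<in> words N n" and a: "\<And>j. j \<in> {1..N} \<Longrightarrow> norm (a j) \<le> K"
    and count: "\<And>k j. k \<le> N * n \<Longrightarrow> j \<in> {1..N} \<Longrightarrow>
      real (count_list (take k w) j) \<le> real k / real N + \<delta>"
    and "0 \<le> \<delta>" "0 < N" "0 < n" "D = real N ^ 2 * \<delta> * K"
  shows "norm (prod_list (map (\<lambda>j. exp (a j /\<^sub>R real n)) w) - exp (\<Sum>j=1..N. a j))
    \<le> (D + 2 * real N * K * exp K * (2 * K + D)) * exp (K * real N) / real n"
proof -
  define s where "s = (\<Sum>j=1..N. a j)"
  \<comment> \<open>The value 0 beyond the end of the word keeps \<open>norm (x i) \<le> K\<close>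
    true for every index, as the product estimate requires.\<close>
  define x where "x i = (if i < N * n then a (w ! i) else 0)" for i
  have len: "length w = N * n" and set_w: "set w \<subseteq> {1..N}"
    using w by (auto simp: words_def)
  have "norm (a 1) \<le> K" using a \<open>0 < N\<close> by simp
  hence K0: "0 \<le> K" using norm_ge_zero order_trans by blast
  have x_le: "norm (x i) \<le> K" for i
  proof (cases "i < N * n")
    case True
    hence "w ! i \<in> {1..N}" using len set_w by (metis nth_mem subsetD)
    thus ?thesis using True a by (simp add: x_def)
  qed (simp add: x_def K0)
  have "norm s \<le> real N * K"
    unfolding s_def using sum_norm_le[of "{1..N}" a "\<lambda>_. K"] a by simp
  hence y_le: "norm (s /\<^sub>R real N) \<le> K"
    using \<open>0 < N\<close> by (simp add: field_simps)
  have T: "norm (\<Sum>i<k. x i - s /\<^sub>R real N) \<le> D" if k: "k \<le> N * n" for k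
  proof -
    have "(\<Sum>i<k. x i) = sum_list (map a (take k w))"
      using k len by (auto simp: sum_list_sum_nth x_def atLeast0LessThan intro!: sum.cong)
    moreover have "norm (sum_list (map a (take k w)) - (real k / real N) *\<^sub>R s) \<le> D"
      using norm_prefix_discrepancy_le[of "take k w" N a K \<delta>] set_w set_take_subset[of k w] a count[OF k]
        len k assms by (simp add: s_def)
    ultimately show ?thesis
      by (simp add: sum_subtractf sum_constant_scaleR divide_inverse del: sum_constant)
  qed
  have "map (\<lambda>i. exp ((1 / real n) *\<^sub>R x i)) [0..<N * n] = map (\<lambda>j. exp (a j /\<^sub>R real n)) w"
    using len by (intro nth_equalityI) (auto simp: x_def divide_inverse)
  moreover have "exp ((1 / real n) *\<^sub>R (s /\<^sub>R real N)) ^ (N * n) = exp s"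
    using \<open>0 < N\<close> \<open>0 < n\<close> by (subst exp_of_nat_scaleR[symmetric]) simp
  moreover have "exp (1 / real n * K) ^ (N * n) = exp (K * real N)"
    using \<open>0 < n\<close> by (simp flip: exp_of_nat_mult)
  ultimately have "norm (prod_list (map (\<lambda>j. exp (a j /\<^sub>R real n)) w) - exp s) \<le>
      (1 / real n * D + real (N * n) * (2 * (1 / real n)\<^sup>2 * K * exp K * (2 * K + D))) * exp (K * real N)"
    using norm_prod_list_exp_diff_le[of "1 / real n" x K "s /\<^sub>R real N" "N * n" D] x_le y_le T \<open>0 < n\<close>
    by simp
  also have "\<dots> = (D + 2 * real N * K * exp K * (2 * K + D)) * exp (K * real N) / real n"
    using \<open>0 < n\<close> by (simp add: field_simps power2_eq_square)
  finally show ?thesis by (simp add: s_def)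
qed

section \<open>Counting words with large discrepancy\<close>

text \<open>The sum factorizes over positions: each of the first \<open>L\<close> contributes
  \<open>b\<close> for the letter \<open>j\<close> and 1 for every other letter, each of the rest
  contributes \<open>card A\<close>. At \<open>b = exp t\<close> this is the unnormalized moment
  generating function of the count.\<close>

lemma sum_power_count_list_take:
  fixes b :: real
  assumes A: "finite A" "j \<in> A" and "L \<le> M"
  shows "(\<Sum>w | set w \<subseteq> A \<and> length w = M. b ^ count_list (take L w) j)
    = (b + real (card A) - 1) ^ L * real (card A) ^ (M - L)"
  using \<open>L \<le> M\<close>
proof (induction M arbitrary: L)
  case 0
  thus ?case by (simp add: conj_commute cong: conj_cong)
next
  case (Suc M)
  show ?case
  proof (cases L)
    case 0
    thus ?thesis using card_lists_length_eq[OF A(1), of "Suc M"] by simp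
  next
    case (Suc L')
    have "(\<Sum>w | set w \<subseteq> A \<and> length w = Suc M. b ^ count_list (take L w) j)
        = (\<Sum>(w, x)\<in>{w. set w \<subseteq> A \<and> length w = M} \<times> A. b ^ count_list (take L (x # w)) j)"
      unfolding lists_length_Suc_eq
      by (subst sum.reindex) (auto simp: inj_on_def intro!: sum.cong)
    also have "\<dots> = (\<Sum>w | set w \<subseteq> A \<and> length w = M. \<Sum>x\<in>A.
        (if x = j then b else 1) * b ^ count_list (take L' w) j)"
      by (subst sum.cartesian_product[symmetric]) (auto simp: Suc intro!: sum.cong)
    also have "\<dots> = (\<Sum>x\<in>A. if x = j then b else 1) *
        (\<Sum>w | set w \<subseteq> A \<and> length w = M. b ^ count_list (take L' w) j)"
      by (simp add: sum_product sum.swap[of _ A])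
    also have "(\<Sum>x\<in>A. if x = j then b else 1) = b + real (card A) - 1"
    proof -
      have "(\<Sum>x\<in>A. if x = j then b else 1) = (\<Sum>x\<in>A. (if x = j then b - 1 else 0) + 1)"
        by (intro sum.cong) auto
      thus ?thesis using A by (simp add: sum.distrib)
    qed
    also have "(\<Sum>w | set w \<subseteq> A \<and> length w = M. b ^ count_list (take L' w) j)
        = (b + real (card A) - 1) ^ L' * real (card A) ^ (M - L')"
      using Suc.prems Suc by (intro Suc.IH) simp
    finally show ?thesis by (simp add: Suc)
  qed
qed

text \<open>Chernoff bound in counting form: every counted word has weight at least 1 under
  \<open>exp (t * (count - L / N - r))\<close>, and the total weight of all words is known from the
  generating function.\<close>

lemma card_lists_prefix_count_gt_le:
  fixes t r :: real
  assumes A: "finite A" "j \<in> A" and "L \<le> M" and t: "0 \<le> t" "t \<le> 1"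
  defines "N \<equiv> real (card A)"
  shows "real (card {w. set w \<subseteq> A \<and> length w = M \<and> real (count_list (take L w) j) > real L / N + r})
    \<le> N ^ M * exp (t\<^sup>2 * real L / N - t * r)"
proof -
  have N: "N \<ge> 1" using A by (auto simp: N_def card_gt_0_iff Suc_le_eq)
  let ?S = "{w. set w \<subseteq> A \<and> length w = M}"
  let ?B = "{w. set w \<subseteq> A \<and> length w = M \<and> real (count_list (take L w) j) > real L / N + r}"
  let ?c = "exp (- t * (real L / N + r))"
  have fin: "finite ?S" using finite_lists_length_eq[OF A(1)] by simp
  have "real (card ?B) = (\<Sum>w\<in>?B. 1)" by simp
  also have "\<dots> \<le> (\<Sum>w\<in>?B. ?c * exp t ^ count_list (take L w) j)"
  proof (rule sum_mono)
    fix w assume "w \<in> ?B"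
    hence "t * (real L / N + r) \<le> t * real (count_list (take L w) j)"
      using t by (intro mult_left_mono) auto
    thus "1 \<le> ?c * exp t ^ count_list (take L w) j"
      by (simp add: exp_of_nat_mult[symmetric] mult_exp_exp mult.commute)
  qed
  also have "\<dots> \<le> (\<Sum>w\<in>?S. ?c * exp t ^ count_list (take L w) j)"
    using fin by (intro sum_mono2) auto
  also have "\<dots> = ?c * ((exp t + N - 1) ^ L * N ^ (M - L))"
    unfolding sum_distrib_left[symmetric] N_def
    by (subst sum_power_count_list_take[OF A \<open>L \<le> M\<close>]) simp
  \<comment> \<open>For \<open>0 \<le> t \<le> 1\<close> one has
    \<open>exp t \<le> 1 + t + t\<^sup>2\<close>. The linear term then cancels against the mean
    \<open>L / N\<close> in \<open>?c\<close>, and only the quadratic one survives.\<close>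
  also have "\<dots> \<le> ?c * ((N * exp ((t + t\<^sup>2) / N)) ^ L * N ^ (M - L))"
  proof -
    have "N * (1 + (t + t\<^sup>2) / N) = N + t + t\<^sup>2"
      using N by (simp add: field_simps)
    hence "exp t + N - 1 \<le> N * (1 + (t + t\<^sup>2) / N)"
      using exp_bound[OF t] by linarith
    also have "\<dots> \<le> N * exp ((t + t\<^sup>2) / N)"
      using N by (intro mult_left_mono exp_ge_add_one_self) auto
    finally have "exp t + N - 1 \<le> N * exp ((t + t\<^sup>2) / N)" .
    moreover have "0 \<le> exp t + N - 1"
      using N exp_ge_zero[of t] by linarith
    ultimately show ?thesis
      using N by (intro mult_left_mono mult_right_mono power_mono) auto
  qed
  also have "\<dots> = N ^ M * (?c * exp (real L * ((t + t\<^sup>2) / N)))"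
  proof -
    have "N ^ M = N ^ L * N ^ (M - L)" using \<open>L \<le> M\<close> by (simp flip: power_add)
    thus ?thesis by (simp only: power_mult_distrib exp_of_nat_mult mult_ac)
  qed
  also have "?c * exp (real L * ((t + t\<^sup>2) / N)) = exp (t\<^sup>2 * real L / N - t * r)"
    using N by (simp add: mult_exp_exp field_simps)
  finally show ?thesis .
qed

section \<open>The number of words with \<open>n\<close> copies of each letter, through permutations
  of a multiset\<close>

lemma words_eq_permutations:
  "words N n = permutations_of_multiset (\<Sum>j=1..N. replicate_mset n j)"
proof -
  let ?m = "\<Sum>j=1..N. replicate_mset n j"
  have cnt: "count ?m x = (if x \<in> {1..N} then n else 0)" for x
    by (simp add: count_sum)
  have size: "size ?m = N * n"
    by (induction N) simp_all
  show ?thesis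
  proof (intro set_eqI iffI)
    fix w assume w: "w \<in> words N n"
    have "count_list w x = (if x \<in> {1..N} then n else 0)" for x
      using w by (auto simp: words_def count_list_0_iff)
    thus "w \<in> permutations_of_multiset ?m"
      by (simp add: permutations_of_multiset_def multiset_eq_iff cnt count_mset del: One_nat_def)
  next
    fix w assume "w \<in> permutations_of_multiset ?m"
    hence w: "mset w = ?m" by (simp add: permutations_of_multiset_def)
    have cl: "count_list w x = (if x \<in> {1..N} then n else 0)" for x
      by (metis w cnt count_mset)
    hence "set w \<subseteq> {1..N}"
      by (metis count_list_0_iff subsetI)
    moreover have "length w = N * n"
      using w size by (metis size_mset)
    ultimately show "w \<in> words N n" using cl by (simp add: words_def)
  qed
qed

lemma finite_words [simp]: "finite (words N n)" and words_nonempty [simp]: "words N n \<noteq> {}"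
  by (simp_all add: words_eq_permutations permutations_of_multiset_nonempty)

lemma card_words: "card (words N n) * fact n ^ N = (fact (N * n) :: nat)"
proof -
  let ?m = "\<Sum>j=1..N. replicate_mset n j"
  have cnt: "count ?m x = (if x \<in> {1..N} then n else 0)" for x
    by (simp add: count_sum)
  have "(\<Prod>x\<in>set_mset ?m. fact (count ?m x)) = (\<Prod>x=1..N. fact n :: nat)"
  proof (rule prod.mono_neutral_cong_left)
    show "set_mset ?m \<subseteq> {1..N}"
      using cnt by (metis count_eq_zero_iff subsetI)
    \<comment> \<open>A letter is absent from \<open>?m\<close> only if \<open>n = 0\<close>, and
      then the extra factors are \<open>fact 0 = 1\<close>.\<close>
    show "\<forall>x\<in>{1..N} - set_mset ?m. fact n = (1 :: nat)"
    proof
      fix x assume "x \<in> {1..N} - set_mset ?m"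
      hence "n = 0" using cnt[of x] by (metis DiffE count_eq_zero_iff)
      thus "fact n = (1 :: nat)" by simp
    qed
    show "fact (count ?m x) = (fact n :: nat)" if "x \<in> set_mset ?m" for x
      using that cnt[of x] by (metis count_eq_zero_iff)
  qed simp
  moreover have "size ?m = N * n" by (induction N) simp_all
  ultimately show ?thesis
    using card_permutations_of_multiset_aux[of ?m] by (simp add: words_eq_permutations)
qed

text \<open>The quotient \<open>n ^ n / fact n\<close> is a single term of the series of
  \<open>exp n\<close>, all of whose terms are nonnegative.\<close>

lemma fact_lower_bound: "real n ^ n \<le> fact n * exp (real n)"
proof -
  have "(\<Sum>k\<in>{n}. real n ^ k /\<^sub>R fact k) \<le> exp (real n)"
    unfolding exp_def by (intro sum_le_suminf summable_exp_generic) auto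
  thus ?thesis by (simp add: field_simps)
qed

text \<open>The induction step amounts to
  \<open>(1 - 1 / (n + 1)) ^ (n + 1) \<le> exp (- 1)\<close>, which follows from
  \<open>1 + x \<le> exp x\<close>.\<close>

lemma fact_upper_bound:
  assumes "n \<ge> 1"
  shows "fact n * exp (real n) \<le> exp 1 * real n * real n ^ n"
  using assms
proof (induction n rule: dec_induct)
  case (step n)
  let ?r = "real n + 1"
  have "(real n / ?r) ^ Suc n \<le> exp (- 1 / ?r) ^ Suc n"
    using exp_ge_add_one_self[of "- 1 / ?r"] by (intro power_mono) (auto simp: field_simps)
  also have "\<dots> = exp (- 1)"
    by (subst exp_of_nat_mult[symmetric]) (simp add: field_simps del: of_nat_Suc add: of_nat_Suc)
  finally have le: "exp 1 * real n ^ Suc n \<le> ?r ^ Suc n"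
    by (simp add: power_divide exp_minus field_simps del: power_Suc)
  have "fact (Suc n) * exp (real (Suc n)) = ?r * exp 1 * (fact n * exp (real n))"
    by (simp add: exp_add algebra_simps)
  also have "\<dots> \<le> ?r * exp 1 * (exp 1 * real n * real n ^ n)"
    using step.IH by (intro mult_left_mono) auto
  also have "\<dots> \<le> ?r * exp 1 * ?r ^ Suc n"
    using le by (intro mult_left_mono) (auto simp: mult_ac)
  finally show ?case by (simp add: mult_ac add.commute)
qed simp

text \<open>Insert the lower factorial bound at \<open>N * n\<close> and the upper one at
  \<open>n\<close> into \<open>card_words\<close>. The exponentials cancel because
  \<open>exp n ^ N = exp (N * n)\<close>, and so do the powers of \<open>n\<close> with exponent
  \<open>N * n\<close>; only a polynomial loss in \<open>n\<close> is left.\<close>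

lemma card_words_lower_bound:
  assumes "n \<ge> 1"
  shows "real N ^ (N * n) \<le> real (card (words N n)) * (exp 1 * real n) ^ N"
proof -
  have "real (N * n) ^ (N * n) * (fact n * exp (real n)) ^ N
      \<le> (fact (N * n) * exp (real (N * n))) * (exp 1 * real n * real n ^ n) ^ N"
    by (intro mult_mono fact_lower_bound power_mono fact_upper_bound assms) auto
  also have "fact (N * n) = real (card (words N n)) * fact n ^ N"
    using arg_cong[OF card_words[of N n], of real] by simp
  finally have "(real n ^ (N * n) * fact n ^ N * exp (real (N * n))) * real N ^ (N * n) \<le>
      (real n ^ (N * n) * fact n ^ N * exp (real (N * n))) * (real (card (words N n)) * (exp 1 * real n) ^ N)"
    by (simp add: power_mult_distrib exp_of_nat_mult[symmetric] mult_ac flip: power_mult exp_of_nat_mult)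
  thus ?thesis
    using assms by (subst (asm) mult_le_cancel_left_pos) auto
qed

section \<open>Summability of the probabilities of words with large discrepancy\<close>

lemma summable_power_times_exp_sqrt:
  "summable (\<lambda>n. real n ^ k * exp (- sqrt (real n) / 4))"
proof (rule summable_comparison_test_bigo)
  show "summable (\<lambda>n. norm (1 / real n ^ 2))"
    using inverse_power_summable[of 2, where 'a = real] by (simp add: field_simps)
  show "(\<lambda>n. real n ^ k * exp (- sqrt (real n) / 4)) \<in> O(\<lambda>n. 1 / real n ^ 2)"
    by real_asymp
qed

text \<open>The exponent 3/4 lies strictly between 1/2, above which the Chernoff bound beats every
  power of \<open>n\<close>, and 1, below which the discrepancy is negligible after division by
  \<open>n\<close>.\<close>

definition bad_words :: "nat \<Rightarrow> nat \<Rightarrow> nat list set" where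
  "bad_words N n = {w \<in> words N n. \<exists>k\<le>N * n. \<exists>j\<in>{1..N}.
     real (count_list (take k w) j) > real k / real N + real n powr (3/4)}"

text \<open>Union bound over the at most \<open>2 * N^2 * n\<close> pairs of a prefix length and a
  letter. The Chernoff bound counts among all \<open>N ^ (N * n)\<close> sequences; passing to the
  fraction of \<open>words N n\<close> costs the factor \<open>(exp 1 * n) ^ N\<close>.\<close>

lemma card_bad_words_le:
  assumes "N \<ge> 1" "n \<ge> 1"
  shows "real (card (bad_words N n)) / real (card (words N n))
    \<le> 2 * real N ^ 2 * exp 1 ^ N * (real n ^ Suc N * exp (- sqrt (real n) / 4))"
proof -
  \<comment> \<open>This \<open>t\<close> minimizes \<open>t\<^sup>2 * n - t * n powr (3/4)\<close>,
    with minimum \<open>- sqrt n / 4\<close>.\<close>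
  define t where "t = real n powr (- 1/4) / 2"
  define B where "B k j = {w. set w \<subseteq> {1..N} \<and> length w = N * n \<and>
    real (count_list (take k w) j) > real k / real N + real n powr (3/4)}" for k j
  have fin: "finite (B k j)" for k j
    by (rule finite_subset[OF _ finite_lists_length_eq[of "{1..N}" "N * n"]]) (auto simp: B_def)
  have t01: "0 \<le> t" "t \<le> 1"
    using assms powr_mono[of "-1/4" 0 "real n"] by (auto simp: t_def)
  have B_le: "real (card (B k j)) \<le> real N ^ (N * n) * exp (- sqrt (real n) / 4)"
    if k: "k \<le> N * n" and j: "j \<in> {1..N}" for k j
  proof -
    have "t\<^sup>2 * real k / real N \<le> t\<^sup>2 * real n"
    proof -
      have "real k / real N \<le> real n"
        using k assms by (simp add: field_simps flip: of_nat_mult)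
      thus ?thesis
        using mult_left_mono[of "real k / real N" "real n" "t\<^sup>2"] by simp
    qed
    also have "t\<^sup>2 * real n = sqrt (real n) / 4"
    proof -
      have "t\<^sup>2 * real n = real n powr (- 1/2) * real n powr 1 / 4"
        using assms by (simp add: t_def power_divide powr_power)
      also have "\<dots> = sqrt (real n) / 4"
        unfolding powr_add[symmetric] by (simp add: powr_half_sqrt)
      finally show ?thesis .
    qed
    finally have "t\<^sup>2 * real k / real N \<le> sqrt (real n) / 4" .
    moreover have "t * real n powr (3/4) = sqrt (real n) / 2"
      by (simp add: t_def powr_half_sqrt[symmetric] flip: powr_add)
    ultimately have "t\<^sup>2 * real k / real N - t * real n powr (3/4) \<le> - sqrt (real n) / 4"
      by linarith
    hence "real N ^ (N * n) * exp (t\<^sup>2 * real k / real N - t * real n powr (3/4)) \<le>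
        real N ^ (N * n) * exp (- sqrt (real n) / 4)"
      by (intro mult_left_mono) auto
    moreover have "real (card (B k j)) \<le>
        real N ^ (N * n) * exp (t\<^sup>2 * real k / real N - t * real n powr (3/4))"
      using card_lists_prefix_count_gt_le[of "{1..N}" j k "N * n" t "real n powr (3/4)"] j k t01
      by (simp add: B_def)
    ultimately show ?thesis by linarith
  qed
  have "bad_words N n \<subseteq> (\<Union>k\<in>{..N * n}. \<Union>j\<in>{1..N}. B k j)"
    by (auto simp: bad_words_def words_def B_def)
  hence "card (bad_words N n) \<le> card (\<Union>k\<in>{..N * n}. \<Union>j\<in>{1..N}. B k j)"
    by (intro card_mono) (auto simp: fin)
  also have "\<dots> \<le> (\<Sum>k\<in>{..N * n}. \<Sum>j\<in>{1..N}. card (B k j))"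
    by (intro order_trans[OF card_UN_le] sum_mono) auto
  finally have "real (card (bad_words N n)) \<le> (\<Sum>k\<in>{..N * n}. \<Sum>j\<in>{1..N}. real (card (B k j)))"
    by (simp flip: of_nat_sum)
  also have "\<dots> \<le> (\<Sum>k\<in>{..N * n}. \<Sum>j\<in>{1..N}. real N ^ (N * n) * exp (- sqrt (real n) / 4))"
    by (intro sum_mono B_le) auto
  also have "\<dots> = real (Suc (N * n)) * real N * exp (- sqrt (real n) / 4) * real N ^ (N * n)"
    by simp
  also have "\<dots> \<le> (2 * real N * real n) * real N * exp (- sqrt (real n) / 4) *
      (real (card (words N n)) * (exp 1 * real n) ^ N)"
  proof -
    have "1 \<le> N * n" using assms by simp
    hence "Suc (N * n) \<le> 2 * N * n" by linarith
    hence "real (Suc (N * n)) \<le> 2 * real N * real n" by (metis of_nat_le_iff of_nat_mult of_nat_numeral)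
    thus ?thesis using assms by (intro mult_mono card_words_lower_bound) auto
  qed
  finally show ?thesis
    by (simp add: divide_le_eq card_gt_0_iff power2_eq_square power_mult_distrib mult_ac)
qed

section \<open>Almost sure convergence\<close>

lemma prob_space_words: "prob_space (uniform_count_measure (words N n))"
  by (rule prob_space_uniform_count_measure) simp_all

lemma AE_eventually_not_bad_words:
  assumes "N \<ge> 1"
  shows "AE w in word_seq_measure N. \<forall>\<^sub>F n in sequentially. w n \<in> words N n - bad_words N n"
proof -
  let ?U = "\<lambda>n. uniform_count_measure (words N n)"
  define M where "M = word_seq_measure N"
  \<comment> \<open>The product measure has coordinates from 1 on, whereas the Borel-Cantelli lemma
    takes a sequence indexed from 0; hence the shift by \<open>Suc\<close>, undone at the
    end.\<close>
  define B where "B n = {w \<in> space M. w (Suc n) \<in> bad_words N (Suc n)}" for n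
  have M: "M = (\<Pi>\<^sub>M n\<in>{1..}. ?U n)" by (simp add: M_def word_seq_measure_def)
  interpret prob_space M
    unfolding M by (rule prob_space_PiM) (rule prob_space_words)
  have bad: "bad_words N n \<in> sets (?U n)" for n
    by (auto simp: sets_uniform_count_measure bad_words_def)
  have meas: "(\<lambda>w. w (Suc n)) \<in> measurable M (?U (Suc n))" for n
    unfolding M by (rule measurable_component_singleton) simp
  have B_eq: "B n = (\<lambda>w. w (Suc n)) -` bad_words N (Suc n) \<inter> space M" for n
    by (auto simp: B_def)
  have B: "B n \<in> sets M" for n
    unfolding B_eq by (rule measurable_sets[OF meas bad])
  have prob_B: "prob (B n) = real (card (bad_words N (Suc n))) / real (card (words N (Suc n)))" for n
  proof -
    have "prob (B n) = measure (distr M (?U (Suc n)) (\<lambda>w. w (Suc n))) (bad_words N (Suc n))"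
      unfolding B_eq by (simp add: measure_distr[OF meas bad])
    \<comment> \<open>The marginal of the product measure is the uniform measure, so the probability
      is the fraction of bad words.\<close>
    also have "distr M (?U (Suc n)) (\<lambda>w. w (Suc n)) = ?U (Suc n)"
      unfolding M by (rule distr_PiM_component[OF prob_space_words]) simp
    finally show ?thesis
      by (simp add: measure_uniform_count_measure bad_words_def)
  qed
  have "summable (\<lambda>n. prob (B n))"
  proof (rule summable_comparison_test')
    show "summable (\<lambda>n. 2 * real N ^ 2 * exp 1 ^ N *
        (real (Suc n) ^ Suc N * exp (- sqrt (real (Suc n)) / 4)))"
      using summable_power_times_exp_sqrt[of "Suc N"]
      by (intro summable_mult) (subst summable_Suc_iff)
    show "norm (prob (B n)) \<le> 2 * real N ^ 2 * exp 1 ^ N *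
        (real (Suc n) ^ Suc N * exp (- sqrt (real (Suc n)) / 4))" for n
      using card_bad_words_le[OF assms, of "Suc n"] unfolding prob_B by simp
  qed
  hence "AE w in M. \<forall>\<^sub>F n in sequentially. w \<in> space M - B n"
    by (intro borel_cantelli_AE1 B) (simp add: emeasure_eq_measure)
  hence "AE w in M. \<forall>\<^sub>F n in sequentially. w n \<in> words N n - bad_words N n"
  proof (rule AE_mp, intro AE_I2 impI)
    fix w assume w: "w \<in> space M" and ev: "\<forall>\<^sub>F n in sequentially. w \<in> space M - B n"
    have "w (Suc n) \<in> words N (Suc n)" for n
      using w by (auto simp: M space_PiM space_uniform_count_measure PiE_iff)
    hence "\<forall>\<^sub>F n in sequentially. w (Suc n) \<in> words N (Suc n) - bad_words N (Suc n)"
      using ev by (auto elim!: eventually_mono simp: B_def)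
    thus "\<forall>\<^sub>F n in sequentially. w n \<in> words N n - bad_words N n"
      by (rule eventually_sequentially_Suc[THEN iffD1])
  qed
  thus ?thesis unfolding M_def .
qed

theorem corollary27:
  fixes N :: nat
    and A :: "nat \<Rightarrow> complex^'d^'d"
    and nrm :: "complex^'d^'d \<Rightarrow> real"
  assumes "N \<ge> 2"
    and "submult_norm nrm"
  shows "AE w in word_seq_measure N.
           (\<lambda>n. nrm (F A n (w n) - mexp (\<Sum>j=1..N. A j))) \<longlonglongrightarrow> 0"
proof -
  obtain C where C: "\<And>X. nrm X \<le> C * norm (alg_of X)"
    using submult_norm_le[OF assms(2)] by blast
  have nrm_nonneg: "0 \<le> nrm X" for X
    using assms(2) by (simp add: submult_norm_def)
  define a where "a j = alg_of (A j)" for j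
  define K where "K = (\<Sum>j=1..N. norm (a j))"
  have K: "norm (a j) \<le> K" if "j \<in> {1..N}" for j
    unfolding K_def using that by (intro member_le_sum) auto
  have alg_sum: "alg_of (\<Sum>j=1..N. A j) = (\<Sum>j=1..N. a j)"
    by (simp add: a_def linear_sum[OF linear_alg_of])
  define D where "D n = real N ^ 2 * real n powr (3/4) * K" for n
  \<comment> \<open>Since \<open>D n\<close> grows at most like \<open>n powr (3/4)\<close>,
    \<open>b n\<close> is of order at most \<open>n powr (-1/4)\<close>.\<close>
  define b where "b n = (D n + 2 * real N * K * exp K * (2 * K + D n)) * exp (K * real N) / real n" for n
  have b: "b \<longlonglongrightarrow> 0"
    unfolding b_def D_def by real_asymp
  have norm_le: "norm (alg_of (F A n w - mexp (\<Sum>j=1..N. A j))) \<le> b n"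
    if "w \<in> words N n - bad_words N n" "n > 0" for n w
  proof -
    have "alg_of (F A n w - mexp (\<Sum>j=1..N. A j)) =
        prod_list (map (\<lambda>j. exp (a j /\<^sub>R real n)) w) - exp (\<Sum>j=1..N. a j)"
      by (simp add: linear_diff[OF linear_alg_of] F_eq_prod_list mexp_eq_exp mat_of_inverse alg_sum
          flip: a_def del: One_nat_def)
    moreover have "real (count_list (take k w) j) \<le> real k / real N + real n powr (3/4)"
      if "k \<le> N * n" "j \<in> {1..N}" for k j
      using that \<open>w \<in> words N n - bad_words N n\<close> by (fastforce simp: bad_words_def not_less)
    ultimately show ?thesis
      using norm_word_product_diff_le[of w N n a K "real n powr (3/4)" "D n"] that K assms(1)
      by (simp add: b_def D_def)
  qed
  show ?thesis
  proof (rule AE_mp[OF AE_eventually_not_bad_words], goal_cases)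
    case 1 thus ?case using assms(1) by simp
  next
    case 2
    show ?case
    proof (intro AE_I2 impI)
      fix w assume ev: "\<forall>\<^sub>F n in sequentially. w n \<in> words N n - bad_words N n"
      \<comment> \<open>The absolute value is taken because the comparison lemma does not state the
        sign of \<open>C\<close>.\<close>
      have "\<forall>\<^sub>F n in sequentially. norm (nrm (F A n (w n) - mexp (\<Sum>j=1..N. A j))) \<le> \<bar>C\<bar> * b n"
        using ev eventually_gt_at_top[of 0]
      proof eventually_elim
        case (elim n)
        let ?X = "F A n (w n) - mexp (\<Sum>j=1..N. A j)"
        have "nrm ?X \<le> \<bar>C\<bar> * norm (alg_of ?X)"
          using C[of ?X] by (rule order_trans) (auto intro!: mult_right_mono)
        also have "\<dots> \<le> \<bar>C\<bar> * b n"
          using norm_le[OF elim] by (intro mult_left_mono) auto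
        finally show ?case using nrm_nonneg by simp
      qed
      moreover have "(\<lambda>n. \<bar>C\<bar> * b n) \<longlonglongrightarrow> 0"
        using b by (rule tendsto_mult_right_zero)
      ultimately show "(\<lambda>n. nrm (F A n (w n) - mexp (\<Sum>j=1..N. A j))) \<longlonglongrightarrow> 0"
        by (rule Lim_null_comparison)
    qed
  qed
qed

end
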